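(* If the set of chords of the chord diagram $D$ has a subset of $p$ parallel chords, then the braid index $b(D)$ of $D$ satisfies $b(D)\ge p+1$.
   Context: An $n$-diagram (chord diagram) is an oriented circle with $2n$ distinct marked points partitioned into $n$ pairs (the chords), up to orientation-preserving homeomorphism. Two chords cross (intersect) if their endpoints alternate around the circle; chords are parallel if they are pairwise non-intersecting. A word on $m$ strands ($m\ge1$) is a word $W=A(i_1,j_1)\cdots A(i_n,j_n)$ in symbols $A(i,j)$, $1\le i<j\le m$, where $A(i,j)$ is viewed as a horizontal chord joining strands $i$ and $j$ of the identity $m$-braid, the letters being placed from top to bottom. Its closure is the $n$-diagram obtained by joining the bottom of strand $k$ to the top of strand $k+1$ ($k<m$) and the bottom of strand $m$ to the top of strand $1$; i.e. the cyclic sequence of chord labels around the circle is $L_1L_2\cdots L_m$, where $L_k$ is the increasing sequence of those $r$ with $k\in\{i_r,j_r\}$. The braid index $b(D)$ is the least $m$ such that $D$ is the closure of a word on $m$ strands. *)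

theory Defs
  imports "HOL-Analysis.Analysis" "HOL-Library.Disjoint_Sets"
begin

text \<open>
  The circle is the unit circle of the complex plane with its counterclockwise orientation.
  A chord is the set of its two endpoints, and a chord diagram is a concrete configuration of
  chords; two configurations are the same diagram iff they are related by
  \<^term>\<open>same_diagram\<close> below.
\<close>

definition n_diagram :: "nat \<Rightarrow> complex set set \<Rightarrow> bool" where
  "n_diagram n D \<longleftrightarrow>
     \<Union>D \<subseteq> sphere 0 1 \<and> finite (\<Union>D) \<and> card (\<Union>D) = 2 * n \<and>
     partition_on (\<Union>D) D \<and> (\<forall>c\<in>D. card c = 2)"

text \<open>
  A homeomorphism of the circle preserves the orientation iff it has an increasing continuous
  lift along the covering \<^term>\<open>cis\<close>.
\<close>

definition orientation_preserving_circle_homeo :: "(complex \<Rightarrow> complex) \<Rightarrow> bool" where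
  "orientation_preserving_circle_homeo h \<longleftrightarrow>
     (\<exists>g. homeomorphism (sphere 0 1) (sphere 0 1) h g) \<and>
     (\<exists>f :: real \<Rightarrow> real. continuous_on UNIV f \<and> strict_mono f \<and> (\<forall>t. h (cis t) = cis (f t)))"

definition same_diagram :: "complex set set \<Rightarrow> complex set set \<Rightarrow> bool" where
  "same_diagram D E \<longleftrightarrow>
     (\<exists>h. orientation_preserving_circle_homeo h \<and> (\<lambda>c. h ` c) ` D = E)"

text \<open>
  The angles \<open>a\<close>, \<open>b\<close>, \<open>a'\<close>, \<open>b'\<close> are met in this order during less than one full turn, so the
  endpoints of the two chords alternate.
\<close>

definition crosses :: "complex set \<Rightarrow> complex set \<Rightarrow> bool" where
  "crosses c d \<longleftrightarrow>
     (\<exists>a b a' b' :: real. a < b \<and> b < a' \<and> a' < b' \<and> b' < a + 2 * pi \<and>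
        c = {cis a, cis a'} \<and> d = {cis b, cis b'})"

definition parallel_chords :: "complex set set \<Rightarrow> bool" where
  "parallel_chords S \<longleftrightarrow> pairwise (\<lambda>c d. \<not> crosses c d) S"

text \<open>The letter \<open>A(i, j)\<close> is the pair \<open>(i, j)\<close>; strands are numbered from 1, letters from 0.\<close>

definition word_on :: "nat \<Rightarrow> (nat \<times> nat) list \<Rightarrow> bool" where
  "word_on m W \<longleftrightarrow> 1 \<le> m \<and> (\<forall>(i, j) \<in> set W. 1 \<le> i \<and> i < j \<and> j \<le> m)"

definition strand_labels :: "(nat \<times> nat) list \<Rightarrow> nat \<Rightarrow> nat list" where
  "strand_labels W k = filter (\<lambda>r. k \<in> {fst (W ! r), snd (W ! r)}) [0..<length W]"

definition closure_labels :: "nat \<Rightarrow> (nat \<times> nat) list \<Rightarrow> nat list" where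
  "closure_labels m W = concat (map (strand_labels W) [1..<Suc m])"

text \<open>
  The label sequence is read counterclockwise, at equally spaced points starting at 1; chord
  \<open>r\<close> consists of the two points labelled \<open>r\<close>.
\<close>

definition word_closure :: "nat \<Rightarrow> (nat \<times> nat) list \<Rightarrow> complex set set" where
  "word_closure m W =
     (let L = closure_labels m W in
      (\<lambda>r. {cis (2 * pi * real a / real (length L)) |a. a < length L \<and> L ! a = r}) `
        {..<length W})"

text \<open>
  The minimum is over a nonempty set: a diagram with \<open>n > 0\<close> chords is the closure of a word on
  \<open>2n\<close> strands, each of which carries one endpoint; the empty diagram closes the empty word on
  one strand.
\<close>

definition braid_index :: "complex set set \<Rightarrow> nat" where
  "braid_index D = (LEAST m. \<exists>W. word_on m W \<and> same_diagram (word_closure m W) D)"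

end

theory Submission
  imports Defs
begin

text \<open>
  Put the endpoint of letter \<open>r\<close> on strand \<open>k\<close> of a word of length \<open>N\<close> at height \<open>k * N + r\<close>. This
  respects the order along the circle, and the length of every chord becomes a positive multiple
  of \<open>N\<close>. A chord of length \<open>d * N\<close> leaves an interval of length only \<open>d * N - 2\<close> for the chords
  nested inside it, hence room for at most \<open>d - 1\<close> of them. By induction, disjoint non-crossing
  chords within an interval of length \<open>\<ell>\<close> number at most \<open>\<ell> / N\<close>. All heights on \<open>m\<close> strands lie
  in an interval of length \<open>m * N - 1\<close>, so fewer than \<open>m\<close> chords are pairwise parallel.
\<close>

section \<open>Counting non-crossing intervals\<close>

lemma noncrossing_count:
  fixes C :: "(nat \<times> nat) set"
  assumes "finite C"
    and "\<And>s t. (s, t) \<in> C \<Longrightarrow> P \<le> s \<and> s < t \<and> t \<le> Q \<and> N dvd t - s"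
    and "\<And>s t s' t'. (s, t) \<in> C \<Longrightarrow> (s', t') \<in> C \<Longrightarrow> (s, t) \<noteq> (s', t') \<Longrightarrow> {s, t} \<inter> {s', t'} = {}"
    and "\<And>s t s' t'. (s, t) \<in> C \<Longrightarrow> (s', t') \<in> C \<Longrightarrow> \<not> (s < s' \<and> s' < t \<and> t < t')"
  shows "N * card C \<le> Q - P"
  using assms
proof (induction "card C" arbitrary: C P Q rule: less_induct)
  case less
  note fin = less.prems(1) and bd = less.prems(2) and disj = less.prems(3) and nc = less.prems(4)
  show ?case
  proof (cases "C = {}")
    case False
    define s where "s = Min (fst ` C)"
    have "s \<in> fst ` C"
      unfolding s_def using False fin by (intro Min_in) auto
    then obtain t where st: "(s, t) \<in> C" by auto
    have least: "s \<le> s'" if "(s', t') \<in> C" for s' t'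
      unfolding s_def using that fin by (intro Min_le) force+
    define C1 where "C1 = {(s', t') \<in> C. s < s' \<and> t' < t}"
    define C2 where "C2 = {(s', t') \<in> C. t < s'}"
    \<comment> \<open>Since \<open>s\<close> is the first endpoint of all, any other chord starts
      after \<open>s\<close>. It shares no endpoint with \<open>(s, t)\<close> and does not cross
      it, so it either stays inside or starts beyond \<open>t\<close>.\<close>
    have "(s', t') = (s, t) \<or> (s', t') \<in> C1 \<or> (s', t') \<in> C2" if "(s', t') \<in> C" for s' t'
      using disj[OF st that] nc[OF st that] least[OF that] that bd[OF that]
      unfolding C1_def C2_def by auto
    then have C: "C = insert (s, t) (C1 \<union> C2)"
      using st by (auto simp: C1_def C2_def)
    have C1: "C1 \<subset> C" and C2: "C2 \<subset> C"
    proof -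
      have "(s, t) \<notin> C1" "(s, t) \<notin> C2" using bd[OF st] by (auto simp: C1_def C2_def)
      then show "C1 \<subset> C" "C2 \<subset> C" using st by (auto simp: C1_def C2_def)
    qed
    have f1: "finite C1" and f2: "finite C2"
      using C1 C2 fin by (auto intro: finite_subset)
    \<comment> \<open>Endpoints of nested chords lie strictly between \<open>s\<close> and
      \<open>t\<close>, so the interval shrinks by one at each end.\<close>
    have l1: "N * card C1 \<le> (t - 1) - (s + 1)"
    proof (rule less.hyps[OF psubset_card_mono[OF fin C1] f1])
      show "s + 1 \<le> a \<and> a < b \<and> b \<le> t - 1 \<and> N dvd b - a" if "(a, b) \<in> C1" for a b
        using that bd[of a b] by (auto simp: C1_def)
    qed (use C1 disj nc in blast)+
    have l2: "N * card C2 \<le> Q - (t + 1)"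
    proof (rule less.hyps[OF psubset_card_mono[OF fin C2] f2])
      show "t + 1 \<le> a \<and> a < b \<and> b \<le> Q \<and> N dvd b - a" if "(a, b) \<in> C2" for a b
        using that bd[of a b] by (auto simp: C2_def)
    qed (use C2 disj nc in blast)+
    obtain d where d: "t - s = N * d" using bd[OF st] by (auto elim: dvdE)
    have "card C \<le> 1 + (card C1 + card C2)"
      unfolding C using f1 f2 card_Un_le[of C1 C2] by (simp add: card_insert_if)
    then have le: "N * card C \<le> N + N * card C1 + N * card C2"
      using mult_le_mono2[of "card C" _ N] by (fastforce simp: distrib_left)
    \<comment> \<open>The loss at the ends makes the inequality strict. As both sides are multiples
      of \<open>N\<close>, they differ by at least \<open>N\<close>, which pays for the chord
      \<open>(s, t)\<close> itself.\<close>
    have "N * card C1 < N * d"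
      using l1 d bd[OF st] by linarith
    then have "card C1 + 1 \<le> d" by simp
    then have "N * card C1 + N \<le> t - s"
      unfolding d using mult_le_mono2[of "card C1 + 1" d N] by simp
    then show ?thesis using le l2 bd[OF st] by linarith
  qed simp
qed

section \<open>From words to intervals of heights\<close>

text \<open>A height \<open>t\<close> encodes strand \<open>t div N\<close> and letter
  \<open>t mod N\<close>. Increasing heights therefore run through the strands in turn, each from
  top to bottom, which is how the closure is read. Heights start at \<open>N\<close> because strands
  are numbered from 1.\<close>

lemma closure_labels_eq:
  fixes W :: "(nat \<times> nat) list"
  defines "N \<equiv> length W"
  shows "closure_labels m W = map (\<lambda>t. t mod N)
    (filter (\<lambda>t. t div N \<in> {fst (W ! (t mod N)), snd (W ! (t mod N))}) [N..<Suc m * N])"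
proof (induction m)
  case 0
  then show ?case by (simp add: closure_labels_def)
next
  case (Suc m)
  let ?P = "\<lambda>t. t div N \<in> {fst (W ! (t mod N)), snd (W ! (t mod N))}"
  have split: "[N..<Suc (Suc m) * N] = [N..<Suc m * N] @ map (\<lambda>r. r + Suc m * N) [0..<N]"
    using upt_add_eq_append[of N "Suc m * N" N] by (simp add: map_add_upt add.commute)
  \<comment> \<open>On the block of strand \<open>Suc m\<close>, shifting by
    \<open>Suc m * N\<close> and reducing modulo \<open>N\<close> cancel; this is the role of
    \<open>map_idI\<close>.\<close>
  have "strand_labels W (Suc m) = map (\<lambda>t. t mod N) (filter ?P (map (\<lambda>r. r + Suc m * N) [0..<N]))"
    unfolding strand_labels_def filter_map map_map N_def[symmetric]
    by (rule sym, rule trans[OF map_idI[where xs="filter _ _"]])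
      (auto intro!: filter_cong simp del: mult_Suc)
  then show ?case
    using Suc unfolding split closure_labels_def by (simp del: mult_Suc)
qed

text \<open>A homeomorphism maps a full turn onto a full turn, since its lift reaches
  \<open>f a + 2 * pi\<close> only where \<^term>\<open>cis\<close> has returned to its value at \<open>a\<close>.\<close>

lemma crosses_image:
  assumes "orientation_preserving_circle_homeo h" and "crosses c d"
  shows "crosses (h ` c) (h ` d)"
proof -
  obtain f g where hom: "homeomorphism (sphere 0 1) (sphere 0 1) h g"
    and f: "continuous_on UNIV f" "strict_mono f" "\<And>t. h (cis t) = cis (f t)"
    using assms(1) unfolding orientation_preserving_circle_homeo_def by blast
  obtain a b a' b' where o: "a < b" "b < a'" "a' < b'" "b' < a + 2 * pi"
    and cd: "c = {cis a, cis a'}" "d = {cis b, cis b'}"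
    using assms(2) unfolding crosses_def by blast
  have "f b' < f a + 2 * pi"
  proof (rule ccontr)
    assume "\<not> f b' < f a + 2 * pi"
    then obtain t where t: "a \<le> t" "t \<le> b'" "f t = f a + 2 * pi"
      using IVT'[of f a "f a + 2 * pi" b'] o continuous_on_subset[OF f(1)] by auto
    then have "h (cis t) = h (cis a)" using f(3) by (simp add: complex_eq_iff)
    then have "cis t = cis a"
      using hom by (metis homeomorphism_apply1 norm_cis mem_sphere_0)
    then obtain k :: int where k: "t = a + 2 * k * pi"
      using sin_cos_eq_iff[of t a] by (auto simp: complex_eq_iff)
    have "t \<noteq> a" using t(3) by auto
    with t k have "2 * k * pi > 0" by linarith
    then have "k \<ge> 1" by (simp add: zero_less_mult_iff)
    then have "2 * k * pi \<ge> 2 * pi" by simp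
    then show False using t o k by linarith
  qed
  then show ?thesis
    unfolding crosses_def cd
    using o strict_monoD[OF f(2)] f(3)
    by (intro exI[of _ "f a"] exI[of _ "f b"] exI[of _ "f a'"] exI[of _ "f b'"]) auto
qed

text \<open>Letters with interleaving heights give crossing chords of the closure, and crossings
  survive the homeomorphism to \<open>D\<close>. Parallel chords thus come from letters to which
  \<open>noncrossing_count\<close> applies. The bound concerns every word closing to
  \<open>D\<close>, minimal or not.\<close>

lemma parallel_count:
  assumes W: "word_on m W" and same: "same_diagram (word_closure m W) D"
    and S: "S \<subseteq> D" and par: "parallel_chords S"
  shows "card S + 1 \<le> m"
proof -
  define N where "N = length W"
  define Q where "Q = (\<lambda>t. t div N \<in> {fst (W ! (t mod N)), snd (W ! (t mod N))})"
  define T where "T = filter Q [N..<Suc m * N]"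
  have L: "closure_labels m W = map (\<lambda>t. t mod N) T"
    unfolding T_def Q_def N_def by (rule closure_labels_eq)
  have sorted: "sorted_wrt (<) T" unfolding T_def by (simp add: sorted_wrt_filter del: mult_Suc)
  define M where "M = length T"
  define x where "x = (\<lambda>a. cis (2 * pi * real a / real M))"
  define ch where "ch = (\<lambda>r. x ` {a. a < M \<and> T ! a mod N = r})"
  have cl: "word_closure m W = ch ` {..<N}"
    unfolding word_closure_def Let_def L ch_def x_def N_def[symmetric] M_def
    by (intro image_cong refl) (auto simp: image_def)
  obtain h where h: "orientation_preserving_circle_homeo h" "(\<lambda>c. h ` c) ` word_closure m W = D"
    using same unfolding same_diagram_def by blast
  have "S \<subseteq> (\<lambda>r. h ` ch r) ` {..<N}" using S h(2) unfolding cl by (simp add: image_image)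
  \<comment> \<open>One label is chosen for each chord of \<open>S\<close>, so that counting labels
    counts chords.\<close>
  then obtain R where R: "R \<subseteq> {..<N}" "inj_on (\<lambda>r. h ` ch r) R" "S = (\<lambda>r. h ` ch r) ` R"
    unfolding subset_image_inj by blast
  define s where "s = (\<lambda>r. fst (W ! r) * N + r)"
  define t where "t = (\<lambda>r. snd (W ! r) * N + r)"
  have bd: "1 \<le> fst (W ! r)" "fst (W ! r) < snd (W ! r)" "snd (W ! r) \<le> m" if "r < N" for r
    using W nth_mem[of r W] that unfolding word_on_def N_def by (auto simp: case_prod_beta)
  have st: "N \<le> s r \<and> s r < t r \<and> t r \<le> m * N + (N - 1) \<and> N dvd t r - s r" if "r < N" for r
  proof -
    have "1 * N \<le> fst (W ! r) * N" "Suc (fst (W ! r)) * N \<le> snd (W ! r) * N"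
      "snd (W ! r) * N \<le> m * N"
      using bd[OF that] by (intro mult_le_mono1; simp)+
    moreover have "t r - s r = (snd (W ! r) - fst (W ! r)) * N"
      unfolding s_def t_def by (simp add: diff_mult_distrib)
    moreover have "N dvd t r - s r" using calculation by simp
    ultimately show ?thesis using that bd(2)[OF that] unfolding s_def t_def mult_Suc
      by linarith
  qed
  have md: "s r mod N = r" "t r mod N = r" if "r < N" for r
    using that unfolding s_def t_def by auto
  have inT: "s r \<in> set T" "t r \<in> set T" if "r < N" for r
    using that st[OF that] unfolding T_def Q_def by (auto simp: md) (auto simp: s_def t_def)
  have onlyT: "v \<in> {s r, t r}" if "v \<in> set T" "v mod N = r" for v r
    using that div_mult_mod_eq[of v N] unfolding T_def Q_def s_def t_def by auto
  have pos: "\<exists>a<M. T ! a = v" if "v \<in> set T" for v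
    using that unfolding M_def by (simp add: in_set_conv_nth)
  \<comment> \<open>\<open>T\<close> lists every height once, so label \<open>r\<close> occurs
    exactly at the positions of \<open>s r\<close> and \<open>t r\<close>.\<close>
  have ch: "ch r = {x a, x b}" if "r < N" "a < M" "T ! a = s r" "b < M" "T ! b = t r" for r a b
  proof -
    have "{a. a < M \<and> T ! a mod N = r} = {a, b}"
    proof (intro equalityI subsetI)
      fix e assume "e \<in> {a. a < M \<and> T ! a mod N = r}"
      then have e: "e < M" "T ! e \<in> {s r, t r}" using onlyT[of "T ! e" r] by (auto simp: M_def)
      have "distinct T" unfolding T_def by simp
      then show "e \<in> {a, b}" using e that unfolding M_def by (auto simp: distinct_conv_nth) metis+
    qed (use that md in auto)
    then show ?thesis unfolding ch_def by simp
  qed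
  \<comment> \<open>Heights, positions in \<open>T\<close> and angles are all in the same order, so
    interleaved heights yield alternating endpoints within one turn.\<close>
  have nc: "\<not> (s r < s q \<and> s q < t r \<and> t r < t q)" if rq: "r \<in> R" "q \<in> R" for r q
  proof
    assume o: "s r < s q \<and> s q < t r \<and> t r < t q"
    have lt: "r < N" "q < N" using rq R by auto
    obtain a b a' b' where ab: "a < M" "T ! a = s r" "b < M" "T ! b = s q"
      "a' < M" "T ! a' = t r" "b' < M" "T ! b' = t q"
      using pos inT lt by metis
    have less: "e < e'" if "T ! e < T ! e'" "e < M" "e' < M" for e e'
      using that sorted sorted_wrt_nth_less[OF sorted, of e' e] unfolding M_def
      by (metis linorder_neqE_nat order_less_asym)
    have ord: "a < b" "b < a'" "a' < b'" using less ab o by metis+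
    have Mpos: "0 < M" using ab by linarith
    have "crosses (ch r) (ch q)"
      unfolding crosses_def
    proof (intro exI conjI)
      show "ch r = {cis (2 * pi * real a / real M), cis (2 * pi * real a' / real M)}"
        using ch[OF lt(1)] ab unfolding x_def by blast
      show "ch q = {cis (2 * pi * real b / real M), cis (2 * pi * real b' / real M)}"
        using ch[OF lt(2)] ab unfolding x_def by blast
      have "2 * pi * real b' / real M < 2 * pi" using ab Mpos by (simp add: field_simps)
      moreover have "0 \<le> 2 * pi * real a / real M" by simp
      ultimately show "2 * pi * real b' / real M < 2 * pi * real a / real M + 2 * pi" by linarith
    qed (use ord Mpos in \<open>auto intro!: divide_strict_right_mono\<close>)
    then have "crosses (h ` ch r) (h ` ch q)" by (rule crosses_image[OF h(1)])
    \<comment> \<open>\<open>pairwise\<close> speaks only of distinct chords; the injective choice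
      of \<open>R\<close> provides this.\<close>
    moreover have "h ` ch r \<noteq> h ` ch q"
      using R(2) rq o by (auto dest: inj_onD)
    moreover have "h ` ch r \<in> S" "h ` ch q \<in> S" using rq R(3) by auto
    ultimately show False
      using par pairwiseD unfolding parallel_chords_def by metis
  qed
  define C where "C = (\<lambda>r. (s r, t r)) ` R"
  have inj: "inj_on (\<lambda>r. (s r, t r)) R"
    using md R(1) by (intro inj_onI) (metis Pair_inject lessThan_iff subsetD)
  have finR: "finite R" using R(1) finite_subset by blast
  have "N * card C \<le> (m * N + (N - 1)) - N"
  proof (rule noncrossing_count)
    show "finite C" unfolding C_def using finR by simp
    show "N \<le> u \<and> u < v \<and> v \<le> m * N + (N - 1) \<and> N dvd v - u" if "(u, v) \<in> C" for u v
      using that st R(1) unfolding C_def by auto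
    \<comment> \<open>A height determines its letter as its residue modulo \<open>N\<close>.\<close>
    show "{u, v} \<inter> {u', v'} = {}" if uv: "(u, v) \<in> C" "(u', v') \<in> C" "(u, v) \<noteq> (u', v')" for u v u' v'
    proof -
      obtain r q where "u = s r" "v = t r" "u' = s q" "v' = t q" "r < N" "q < N" "r \<noteq> q"
        using uv R(1) unfolding C_def by blast
      moreover from this have "s r mod N \<noteq> s q mod N" "s r mod N \<noteq> t q mod N"
        "t r mod N \<noteq> s q mod N" "t r mod N \<noteq> t q mod N" by (simp_all only: md not_False_eq_True)
      ultimately show ?thesis by auto
    qed
    show "\<not> (u < u' \<and> u' < v \<and> v < v')" if "(u, v) \<in> C" "(u', v') \<in> C" for u v u' v'
      using that nc unfolding C_def by auto
  qed
  moreover have "card C = card S"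
    unfolding C_def using card_image[OF inj] card_image[OF R(2)] R(3) by simp
  ultimately have le: "N * card S \<le> (m * N + (N - 1)) - N" by simp
  have m1: "1 \<le> m" using W unfolding word_on_def by simp
  show ?thesis
  \<comment> \<open>For the empty word the count reads 0 \<le> 0 and says nothing; then
    \<open>S\<close> is empty and one strand suffices. Otherwise the right-hand side is
    \<open>m * N - 1\<close>.\<close>
  proof (cases "N = 0")
    case True
    then show ?thesis using R m1 by simp
  next
    case False
    then have "N * card S < N * m" using le m1 by (cases m) (auto simp: algebra_simps)
    then show ?thesis by simp
  qed
qed

section \<open>Circle homeomorphisms from lifts\<close>

text \<open>A lift that commutes with the full turn descends to the circle, injectively by strict
  monotonicity. Its continuity follows from being monotone and onto, and that of the inverse from
  compactness of the circle.\<close>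

lemma circle_homeo_of_lift:
  fixes f :: "real \<Rightarrow> real"
  assumes mono: "strict_mono f" and surj: "surj f" and period: "\<And>t. f (t + 2 * pi) = f t + 2 * pi"
  obtains h where "orientation_preserving_circle_homeo h" "\<And>t. h (cis t) = cis (f t)"
proof -
  have cont: "continuous_on UNIV f"
    using mono surj by (intro continuous_onI_mono) (auto simp: strict_mono_less_eq)
  have periodn: "f (t + 2 * real n * pi) = f t + 2 * real n * pi" for t n
  proof (induction n)
    case (Suc n)
    have "f (t + 2 * real (Suc n) * pi) = f ((t + 2 * real n * pi) + 2 * pi)"
      by (simp add: algebra_simps)
    then show ?case using Suc by (simp only: period) (simp add: algebra_simps)
  qed simp
  have periodi: "f (t + 2 * of_int k * pi) = f t + 2 * of_int k * pi" for t and k :: int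
  proof (cases k)
    case (nonneg n)
    then show ?thesis using periodn[of t n] by simp
  next
    case (neg n)
    then have "real_of_int k = - real (Suc n)" by simp
    moreover from this have "t + 2 * of_int k * pi + 2 * real (Suc n) * pi = t"
      by (simp del: of_nat_Suc)
    ultimately show ?thesis using periodn[of "t + 2 * of_int k * pi" "Suc n"] by (simp only:)
  qed
  have cis_iff: "cis s = cis t \<longleftrightarrow> (\<exists>k::int. s = t + 2 * k * pi)" for s t
    using sin_cos_eq_iff[of s t] by (auto simp: complex_eq_iff)
  have cis_f: "cis (f s) = cis (f t) \<longleftrightarrow> cis s = cis t" for s t
    unfolding cis_iff periodi[symmetric] using strict_mono_eq[OF mono] by auto
  define h where "h = (\<lambda>z. cis (f (Arg z)))"
  \<comment> \<open>\<open>Arg\<close> jumps on the negative real axis, \<open>Arg2pi\<close> on the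
    positive one. Both describe the same \<open>h\<close> on the circle, because
    \<open>cis (f t)\<close> depends only on \<open>cis t\<close>; so near each point a continuous
    choice of argument is available.\<close>
  have h2: "h z = cis (f (Arg2pi z))" if "norm z = 1" for z
  proof -
    have "cis (Arg2pi z) = z" using Arg2pi_eq[of z] that by (simp add: cis_conv_exp)
    moreover have "cis (Arg z) = z"
      using cis_Arg[of z] that by (cases "z = 0") (auto simp: sgn_div_norm)
    ultimately show ?thesis unfolding h_def cis_f by simp
  qed
  have hc: "h (cis t) = cis (f t)" for t
    unfolding h_def cis_f by (simp add: cis_Arg sgn_div_norm)
  have sph: "\<exists>t. z = cis t" if "z \<in> sphere 0 1" for z
    using that by (metis cis_Arg mem_sphere_0 norm_zero sgn_eq zero_neq_one div_by_1 of_real_1)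
  have conth: "continuous_on (sphere 0 1) h"
    unfolding continuous_on_eq_continuous_within
  proof
    fix z :: complex assume z: "z \<in> sphere 0 1"
    have cf: "isCont (\<lambda>u. cis (f u)) u" for u
      using continuous_on_cis[OF cont] by (simp add: continuous_on_eq_continuous_at)
    show "continuous (at z within sphere 0 1) h"
    proof (cases "z \<in> \<real>\<^sub>\<le>\<^sub>0")
      case False
      then have "isCont (\<lambda>z. cis (f (Arg z))) z"
        by (intro isCont_o2[OF continuous_at_Arg cf])
      then show ?thesis unfolding h_def by (rule continuous_at_imp_continuous_at_within)
    next
      case True
      then have "z \<notin> \<real>\<^sub>\<ge>\<^sub>0" using z by (auto simp: complex_nonpos_Reals_iff complex_nonneg_Reals_iff cmod_def)
      then have "isCont (\<lambda>z. cis (f (Arg2pi z))) z"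
        by (intro isCont_o2[OF continuous_at_Arg2pi cf])
      then have "continuous (at z within sphere 0 1) (\<lambda>z. cis (f (Arg2pi z)))"
        by (rule continuous_at_imp_continuous_at_within)
      then show ?thesis
        by (rule continuous_transform_within[where \<delta>=1]) (use z h2 in auto)
    qed
  qed
  have "inj_on h (sphere 0 1)"
    by (intro inj_onI) (metis sph hc cis_f)
  moreover have "h ` sphere 0 1 = sphere 0 1"
  proof (intro equalityI subsetI)
    fix z :: complex assume "z \<in> sphere 0 1"
    then obtain t where "z = cis (f t)" using sph surj by (metis surjD)
    then show "z \<in> h ` sphere 0 1" using hc by (metis imageI mem_sphere_0 norm_cis)
  qed (auto simp: h_def)
  ultimately obtain g where "homeomorphism (sphere 0 1) (sphere 0 1) h g"
    using homeomorphism_compact[OF compact_sphere conth] by blast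
  then have "orientation_preserving_circle_homeo h"
    unfolding orientation_preserving_circle_homeo_def using cont mono hc by blast
  then show thesis using that hc by blast
qed

text \<open>The function is piecewise linear with values \<theta> at the integers. It is onto
  because \<theta> gains c > 0 in every period and so is unbounded in both directions.\<close>

lemma strict_mono_interpolation:
  fixes \<theta> :: "int \<Rightarrow> real" and M :: nat
  assumes less: "\<And>k. \<theta> k < \<theta> (k + 1)" and M: "0 < M"
    and period: "\<And>k. \<theta> (k + int M) = \<theta> k + c" and c: "0 < c"
  obtains f :: "real \<Rightarrow> real" where "strict_mono f" "surj f"
    "\<And>u. f (u + real M) = f u + c" "\<And>k. f (of_int k) = \<theta> k"
proof
  define f where "f = (\<lambda>u. \<theta> \<lfloor>u\<rfloor> + frac u * (\<theta> (\<lfloor>u\<rfloor> + 1) - \<theta> \<lfloor>u\<rfloor>))"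
  have mono: "\<theta> j \<le> \<theta> k" if "j \<le> k" for j k
    using that by (induction k rule: int_ge_induct) (auto intro: order_trans less_imp_le less)
  have lo: "\<theta> \<lfloor>u\<rfloor> \<le> f u" for u
    unfolding f_def using less[of "\<lfloor>u\<rfloor>"] by (simp add: frac_ge_0)
  have hi: "f u < \<theta> (\<lfloor>u\<rfloor> + 1)" for u
  proof -
    have "frac u * (\<theta> (\<lfloor>u\<rfloor> + 1) - \<theta> \<lfloor>u\<rfloor>) < 1 * (\<theta> (\<lfloor>u\<rfloor> + 1) - \<theta> \<lfloor>u\<rfloor>)"
      using less[of "\<lfloor>u\<rfloor>"] frac_lt_1[of u] by (intro mult_strict_right_mono) auto
    then show ?thesis unfolding f_def by simp
  qed
  show "strict_mono f"
  proof (rule strict_monoI)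
    fix u v :: real assume uv: "u < v"
    show "f u < f v"
    proof (cases "\<lfloor>u\<rfloor> = \<lfloor>v\<rfloor>")
      case True
      then show ?thesis unfolding f_def frac_def using uv less[of "\<lfloor>v\<rfloor>"] by simp
    next
      case False
      then have "\<lfloor>u\<rfloor> + 1 \<le> \<lfloor>v\<rfloor>" using uv floor_mono[of u v] by linarith
      then show ?thesis using hi[of u] mono lo[of v] by fastforce
    qed
  qed
  show fM: "f (u + real M) = f u + c" for u
  proof -
    have "\<lfloor>u + real M\<rfloor> = \<lfloor>u\<rfloor> + int M" "frac (u + real M) = frac u"
      by (auto simp: frac_def)
    moreover have "\<theta> (\<lfloor>u\<rfloor> + int M + 1) = \<theta> (\<lfloor>u\<rfloor> + 1) + c"
      using period[of "\<lfloor>u\<rfloor> + 1"] by (simp add: algebra_simps)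
    ultimately show ?thesis unfolding f_def by (simp add: period)
  qed
  show "f (of_int k) = \<theta> k" for k unfolding f_def by simp
  have up: "\<theta> (int (n * M)) = \<theta> 0 + n * c" for n
  proof (induction n)
    case (Suc n)
    then show ?case using period[of "int (n * M)"] by (simp add: algebra_simps)
  qed simp
  have down: "\<theta> (- int (n * M)) = \<theta> 0 - n * c" for n
  proof (induction n)
    case (Suc n)
    then show ?case using period[of "- int (Suc n * M)"] by (simp add: algebra_simps)
  qed simp
  show "surj f"
  unfolding surj_def
  proof
    fix y :: real
    obtain n :: nat where n: "real n * c > \<bar>y\<bar> + \<bar>\<theta> 0\<bar>"
      using reals_Archimedean3[OF c] by blast
    \<comment> \<open>A discrete intermediate value argument: otherwise \<theta> k \<le> y would
      propagate from \<open>- n * M\<close> up to \<open>n * M\<close>, where \<theta> already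
      exceeds \<open>y\<close>.\<close>
    have "\<exists>k. \<theta> k \<le> y \<and> y < \<theta> (k + 1)"
    proof (rule ccontr)
      assume no: "\<not> ?thesis"
      have "\<theta> k \<le> y" if "- int (n * M) \<le> k" for k
        using that
      proof (induction k rule: int_ge_induct)
        case base
        then show ?case using down[of n] n by simp
      next
        case (step k)
        then show ?case using no by (meson not_le)
      qed
      from this[of "int (n * M)"] show False using up[of n] n by simp
    qed
    then obtain k where k: "\<theta> k \<le> y" "y < \<theta> (k + 1)" by blast
    define e where "e = (y - \<theta> k) / (\<theta> (k + 1) - \<theta> k)"
    have e: "0 \<le> e" "e < 1" "e * (\<theta> (k + 1) - \<theta> k) = y - \<theta> k"
      unfolding e_def using k by (auto simp: field_simps)
    have "\<lfloor>of_int k + e\<rfloor> = k" using e by (simp add: floor_eq_iff)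
    then have "f (of_int k + e) = y" unfolding f_def frac_def using e by simp
    then show "\<exists>u. y = f u" by blast
  qed
qed

section \<open>Every chord diagram is the closure of a word\<close>

lemma filter_eq_upt: "k < n \<Longrightarrow> filter (\<lambda>r. r = k) [0..<n] = [k]"
  by (induction n) (auto simp: less_Suc_eq filter_empty_conv)

lemma sorted_angles:
  assumes "finite X" and "X \<subseteq> sphere 0 1" and "card X = M"
  obtains \<theta> :: "nat \<Rightarrow> real" where "\<And>a b. a < b \<Longrightarrow> b < M \<Longrightarrow> \<theta> a < \<theta> b"
    "\<And>a. a < M \<Longrightarrow> 0 \<le> \<theta> a \<and> \<theta> a < 2 * pi" "bij_betw (\<lambda>a. cis (\<theta> a)) {..<M} X"
proof
  define A where "A = Arg2pi ` X"
  define xs where "xs = sorted_list_of_set A"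
  have cisA: "cis (Arg2pi z) = z" if "z \<in> X" for z
    using Arg2pi_eq[of z] that assms(2) by (auto simp: cis_conv_exp)
  have inj: "inj_on Arg2pi X" by (rule inj_on_inverseI[of _ cis]) (rule cisA)
  have fin: "finite A" and card: "card A = M"
    unfolding A_def using assms card_image[OF inj] by auto
  have len: "length xs = M" and set: "set xs = A" and dist: "distinct xs"
    and sort: "sorted_wrt (<) xs"
    unfolding xs_def using fin card by auto
  show "xs ! a < xs ! b" if "a < b" "b < M" for a b
    using sorted_wrt_nth_less[OF sort that(1)] that len by simp
  show "0 \<le> xs ! a \<and> xs ! a < 2 * pi" if "a < M" for a
    using nth_mem[of a xs] that len set Arg2pi_ge_0 Arg2pi_lt_2pi unfolding A_def by auto
  have "bij_betw ((!) xs) {..<M} A"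
    using bij_betw_nth[OF dist] len set by simp
  moreover have "bij_betw cis A X"
    unfolding A_def by (rule bij_betw_byWitness[of _ Arg2pi]) (auto simp: cisA)
  ultimately show "bij_betw (\<lambda>a. cis (xs ! a)) {..<M} X"
    using bij_betw_trans unfolding comp_def by blast
qed

text \<open>The angles are continued to all integers by adding a full turn every \<open>M\<close>
  steps. Interpolating them and rescaling so that the equally spaced points become integers gives a
  lift of the desired map.\<close>

lemma homeo_to_sorted_angles:
  fixes \<theta> :: "nat \<Rightarrow> real"
  assumes M: "0 < M" and mono: "\<And>a b. a < b \<Longrightarrow> b < M \<Longrightarrow> \<theta> a < \<theta> b"
    and bd: "\<And>a. a < M \<Longrightarrow> 0 \<le> \<theta> a \<and> \<theta> a < 2 * pi"
  obtains h where "orientation_preserving_circle_homeo h"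
    "\<And>a. a < M \<Longrightarrow> h (cis (2 * pi * real a / real M)) = cis (\<theta> a)"
proof -
  define \<theta>' :: "int \<Rightarrow> real" where
    "\<theta>' = (\<lambda>k. \<theta> (nat (k mod int M)) + 2 * pi * of_int (k div int M))"
  have less: "\<theta>' k < \<theta>' (k + 1)" for k
  proof -
    define q i where "q = k div int M" and "i = nat (k mod int M)"
    have i: "i < M" and k: "k = q * int M + int i"
      unfolding q_def i_def using M by (auto simp: nat_less_iff)
    show ?thesis
    proof (cases "Suc i < M")
      case True
      have k1: "k + 1 = int (Suc i) + q * int M" using k by simp
      have "(k + 1) div int M = q" "(k + 1) mod int M = int (Suc i)"
        unfolding k1 using True by (simp_all del: of_nat_Suc)
      then have "\<theta>' (k + 1) = \<theta> (Suc i) + 2 * pi * of_int q" unfolding \<theta>'_def by (simp del: of_nat_Suc)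
      then show ?thesis unfolding \<theta>'_def q_def[symmetric] i_def[symmetric]
        using mono[of i "Suc i"] True by simp
    next
      \<comment> \<open>At the wrap-around the last angle is below \<open>2 * pi\<close>, while the
        next one is \<theta> 0 plus a full turn.\<close>
      case False
      then have "k + 1 = (q + 1) * int M" using k i by (simp add: algebra_simps)
      then have "\<theta>' (k + 1) = \<theta> 0 + 2 * pi * of_int (q + 1)" unfolding \<theta>'_def using M by simp
      then show ?thesis unfolding \<theta>'_def q_def[symmetric] i_def[symmetric]
        using bd[of i] bd[of 0] i by (simp add: algebra_simps)
    qed
  qed
  have period: "\<theta>' (k + int M) = \<theta>' k + 2 * pi" for k
    unfolding \<theta>'_def using M by (simp add: algebra_simps)
  obtain f where f: "strict_mono f" "surj f"
    "\<And>u. f (u + real M) = f u + 2 * pi" "\<And>k. f (of_int k) = \<theta>' k"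
    by (rule strict_mono_interpolation[of \<theta>' M "2 * pi", OF less M period]) auto
  define F where "F = (\<lambda>t. f (t * (real M / (2 * pi))))"
  have pos: "real M / (2 * pi) > 0" using M by simp
  have "strict_mono F"
    unfolding F_def using mult_strict_right_mono[OF _ pos] strict_monoD[OF f(1)]
    by (intro strict_monoI) blast
  moreover have "surj F"
  unfolding surj_def
  proof
    fix y
    obtain u where "y = f u" using f(2) by (metis surjD)
    then have "y = F (u / (real M / (2 * pi)))" unfolding F_def using M by simp
    then show "\<exists>t. y = F t" by blast
  qed
  moreover have "F (t + 2 * pi) = F t + 2 * pi" for t
    unfolding F_def f(3)[symmetric] by (simp add: field_simps)
  ultimately obtain h where h: "orientation_preserving_circle_homeo h" "\<And>t. h (cis t) = cis (F t)"
    using circle_homeo_of_lift by metis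
  have "F (2 * pi * real a / real M) = \<theta> a" if "a < M" for a
  proof -
    have "F (2 * pi * real a / real M) = f (of_int (int a))" unfolding F_def using M by simp
    then show ?thesis unfolding f(4) \<theta>'_def using that by simp
  qed
  then show thesis using that h by metis
qed

text \<open>Each endpoint gets its own strand. Without this, \<^const>\<open>braid_index\<close> would be an
  unspecified \<^const>\<open>Least\<close>.\<close>

lemma ex_word_closure:
  assumes D: "n_diagram n D"
  shows "\<exists>m W. word_on m W \<and> same_diagram (word_closure m W) D"
proof (cases "n = 0")
  \<comment> \<open>A word needs at least one strand, so \<open>2 * n\<close> strands will not do
    for the empty diagram.\<close>
  case True
  have "\<Union>D = {}" "{} \<notin> D" using D True unfolding n_diagram_def partition_on_def by auto
  then have "D = {}" by auto
  moreover have "orientation_preserving_circle_homeo id"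
    unfolding orientation_preserving_circle_homeo_def
  proof
    show "\<exists>g. homeomorphism (sphere 0 1) (sphere 0 1) (id :: complex \<Rightarrow> complex) g"
      using homeomorphism_ident unfolding id_def by blast
    show "\<exists>f :: real \<Rightarrow> real. continuous_on UNIV f \<and> strict_mono f \<and> (\<forall>t. id (cis t) = cis (f t))"
      by (rule exI[of _ id]) (auto simp: strict_mono_def id_def)
  qed
  ultimately have "same_diagram (word_closure 1 []) D"
    unfolding same_diagram_def word_closure_def by auto
  then show ?thesis by (intro exI[of _ 1] exI[of _ "[]"]) (simp add: word_on_def)
next
  case False
  define M where "M = 2 * n"
  have M: "0 < M" using False unfolding M_def by simp
  have X: "finite (\<Union>D)" "\<Union>D \<subseteq> sphere 0 1" "card (\<Union>D) = M"
    and disj: "disjoint D" and c2: "\<And>c. c \<in> D \<Longrightarrow> card c = 2"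
    using D unfolding n_diagram_def partition_on_def M_def by auto
  obtain \<theta> where \<theta>: "\<And>a b. a < b \<Longrightarrow> b < M \<Longrightarrow> \<theta> a < \<theta> b"
    "\<And>a. a < M \<Longrightarrow> 0 \<le> \<theta> a \<and> \<theta> a < 2 * pi" "bij_betw (\<lambda>a. cis (\<theta> a)) {..<M} (\<Union>D)"
    using sorted_angles[OF X] by blast
  obtain h where h: "orientation_preserving_circle_homeo h"
    "\<And>a. a < M \<Longrightarrow> h (cis (2 * pi * real a / real M)) = cis (\<theta> a)"
    using homeo_to_sorted_angles[of M \<theta>] M \<theta>(1,2) by blast
  \<comment> \<open>Any order of the chords serves, since each strand will meet only one
    letter.\<close>
  obtain cs where cs: "set cs = D" "distinct cs"
    using finite_distinct_list[OF finite_UnionD[OF X(1)]] by blast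
  define I where "I = (\<lambda>c. {a. a < M \<and> cis (\<theta> a) \<in> c})"
  have img: "(\<lambda>a. cis (\<theta> a)) ` I c = c" if "c \<in> D" for c
  proof -
    have "c \<subseteq> (\<lambda>a. cis (\<theta> a)) ` {..<M}"
      using bij_betw_imp_surj_on[OF \<theta>(3)] that by auto
    then show ?thesis unfolding I_def by auto
  qed
  have cardI: "card (I c) = 2" if "c \<in> D" for c
  proof -
    have "inj_on (\<lambda>a. cis (\<theta> a)) (I c)"
      using \<theta>(3) unfolding bij_betw_def I_def by (auto intro: inj_on_subset)
    then show ?thesis using card_image img[OF that] c2[OF that] by metis
  qed
  have finI: "finite (I c)" for c unfolding I_def by simp
  have I: "I c = {Min (I c), Max (I c)}" "Min (I c) < Max (I c)" if c: "c \<in> D" for c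
  proof -
    obtain a b where ab: "I c = {a, b}" "a \<noteq> b" using cardI[OF c] by (auto simp: card_2_iff)
    then show "I c = {Min (I c), Max (I c)}" "Min (I c) < Max (I c)"
      by (auto simp: min_def max_def)
  qed
  \<comment> \<open>Endpoint positions count from 0 and strands from 1, hence
    \<open>Suc\<close>.\<close>
  define W where "W = map (\<lambda>c. (Suc (Min (I c)), Suc (Max (I c)))) cs"
  have word: "word_on M W"
  proof -
    have "Max (I c) < M" if "c \<in> D" for c
      using Max_in[OF finI, of c] I[OF that] unfolding I_def by blast
    then show ?thesis using I(2) M unfolding word_on_def W_def by (auto simp: cs(1) Suc_le_eq)
  qed
  have ex: "\<exists>r<length cs. a \<in> I (cs ! r)" if "a < M" for a
  proof -
    have "cis (\<theta> a) \<in> \<Union>D" using \<theta>(3) that unfolding bij_betw_def by blast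
    then show ?thesis using that unfolding I_def cs(1)[symmetric] by (auto simp: in_set_conv_nth)
  qed
  have uniq: "r = q" if "r < length cs" "q < length cs" "a \<in> I (cs ! r)" "a \<in> I (cs ! q)" for r q a
  proof -
    have "cs ! r = cs ! q"
      using that disj nth_mem[of _ cs] unfolding I_def cs(1) disjoint_def by blast
    then show ?thesis using that cs(2) nth_eq_iff_index_eq by blast
  qed
  obtain lab where lab: "\<And>a. a < M \<Longrightarrow> lab a < length cs \<and> a \<in> I (cs ! lab a)"
    using ex by metis
  have strand: "strand_labels W (Suc a) = [lab a]" if "a < M" for a
  proof -
    have "strand_labels W (Suc a) = filter (\<lambda>r. r = lab a) [0..<length cs]"
      unfolding strand_labels_def
    proof (rule filter_cong)
      fix r assume "r \<in> set [0..<length cs]"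
      then have r: "r < length cs" by simp
      then have "cs ! r \<in> D" using cs by auto
      then have "Suc a \<in> {fst (W ! r), snd (W ! r)} \<longleftrightarrow> a \<in> I (cs ! r)"
        using I(1)[of "cs ! r"] r unfolding W_def by auto
      then show "Suc a \<in> {fst (W ! r), snd (W ! r)} \<longleftrightarrow> r = lab a"
        using lab[OF that] uniq r by blast
    qed (simp add: W_def)
    also have "\<dots> = [lab a]"
      using lab[OF that] by (simp add: filter_eq_upt)
    finally show ?thesis .
  qed
  have L: "closure_labels M W = map lab [0..<M]"
  proof -
    have "closure_labels M W = concat (map (\<lambda>a. [lab a]) [0..<M])"
      unfolding closure_labels_def map_Suc_upt[symmetric] One_nat_def map_map
      by (intro arg_cong[of _ _ concat] map_cong) (auto simp: strand)
    then show ?thesis by simp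
  qed
  \<comment> \<open>Position \<open>a\<close> of the closure carries the label of the chord through
    the endpoint at angle \<theta> a, and \<open>h\<close> moves that position to this
    endpoint.\<close>
  have chord: "h ` {cis (2 * pi * real a / real M) |a. a < M \<and> lab a = r} = cs ! r"
    if "r < length cs" for r
  proof -
    have "I (cs ! r) = {a. a < M \<and> lab a = r}"
      using lab uniq that unfolding I_def by blast
    moreover have "cs ! r \<in> D" using that cs by auto
    ultimately have "cs ! r = (\<lambda>a. cis (\<theta> a)) ` {a. a < M \<and> lab a = r}" using img by metis
    also have "\<dots> = h ` (\<lambda>a. cis (2 * pi * real a / real M)) ` {a. a < M \<and> lab a = r}"
      unfolding image_image using h(2) by (intro image_cong) auto
    finally show ?thesis unfolding setcompr_eq_image by simp
  qed
  have "word_closure M W = (\<lambda>r. {cis (2 * pi * real a / real M) |a. a < M \<and> lab a = r}) ` {..<length cs}"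
    unfolding word_closure_def L Let_def by (intro image_cong) (auto simp: W_def)
  then have "(\<lambda>c. h ` c) ` word_closure M W = (\<lambda>r. cs ! r) ` {..<length cs}"
    by (simp add: image_image chord)
  also have "\<dots> = D" using cs(1) by (auto simp: in_set_conv_nth)
  finally show ?thesis using h(1) word unfolding same_diagram_def by blast
qed

theorem proposition3p6:
  fixes D S :: "complex set set" and n p :: nat
  assumes "n_diagram n D"
    and "S \<subseteq> D"
    and "parallel_chords S"
    and "card S = p"
  shows "braid_index D \<ge> p + 1"
proof -
  \<comment> \<open>The minimum is attained, so the bound for arbitrary words applies to a minimal
    one.\<close>
  have "\<exists>W. word_on (braid_index D) W \<and> same_diagram (word_closure (braid_index D) W) D"
    unfolding braid_index_def using ex_word_closure[OF assms(1)] by (rule LeastI_ex)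
  then show ?thesis using parallel_count assms by blast
qed

end
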